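(* Suppose $k$ is a positive integer and $l = 3^{k-1}\cdot r$, where $r$ is a positive odd integer. If $N = \left(\frac{2}{3}\right)^k\left(2^l+1\right)-1$, then the Collatz sequence beginning with $N$ terminates at $1$ after $l+k$ steps.
   Context: The Collatz algorithm on positive integers sends $n$ to $n/2$ if $n$ is even and to $(3n+1)/2$ if $n$ is odd. The Collatz sequence beginning with $N$ is the sequence of positive integers obtained by applying this algorithm repeatedly, starting from $N$. One step is one application of the algorithm. The sequence terminates at $1$ after $s$ steps if its first term equal to $1$ is reached after exactly $s$ steps, the sequence being stopped there. For example, $21\to 32\to 16\to 8\to 4\to 2\to 1$ terminates at $1$ after 6 steps.
   Formalization: The single case k = r = 1 is excluded: there l = 1 and N = 1, so the sequence is already at 1 after 0 steps rather than l + k = 2; every other case is covered. *)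

theory Defs
  imports Complex_Main
begin

(* The map is only meaningful on positive integers, which it preserves; the value at 0 is junk.
   In the odd case 3 * n + 1 is even, so div is exact. *)
definition collatz :: "nat \<Rightarrow> nat" where
  "collatz n = (if even n then n div 2 else (3 * n + 1) div 2)"

definition collatz_seq :: "nat \<Rightarrow> nat \<Rightarrow> nat" where
  "collatz_seq N i = (collatz ^^ i) N"

(* The starting value is term 0, so the sequence beginning with 1 terminates after 0 steps. *)
definition terminates_at_1_after :: "nat \<Rightarrow> nat \<Rightarrow> bool" where
  "terminates_at_1_after N s \<longleftrightarrow> collatz_seq N s = 1 \<and> (\<forall>i<s. collatz_seq N i \<noteq> 1)"

lemma terminates_at_1_after_1_iff: "terminates_at_1_after 1 s \<longleftrightarrow> s = 0"
  by (auto simp: terminates_at_1_after_def collatz_seq_def)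

lemma terminates_at_1_after_21: "terminates_at_1_after 21 6"
proof -
  have step: "collatz_seq N 0 = N" "collatz_seq N (Suc i) = collatz (collatz_seq N i)" for N i
    by (simp_all add: collatz_seq_def)
  have six: "6 = Suc (Suc (Suc (Suc (Suc (Suc 0)))))"
    by simp
  show ?thesis
    unfolding terminates_at_1_after_def six
    by (simp only: step All_less_Suc) (simp add: collatz_def step)
qed

end

theory Submission
  imports Defs
begin

text \<open>
  By induction on \<open>k\<close>, \<open>3 ^ k\<close> divides \<open>2 ^ l + 1\<close>; let \<open>m\<close> be the quotient, so
  \<open>N = 2 ^ k * m - 1\<close>. Each step from \<open>2 * b - 1\<close> leads to \<open>3 * b - 1\<close>, so the first \<open>k\<close> steps
  trade the factors \<open>2\<close> for factors \<open>3\<close> and end at \<open>3 ^ k * m - 1 = 2 ^ l\<close>, which is then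
  halved \<open>l\<close> times. A term \<open>3 ^ j * 2 ^ (k - j) * m - 1\<close> equals \<open>1\<close> only if \<open>j = 0\<close> and \<open>k = m = 1\<close>,
  the excluded case.
\<close>

text \<open>Raising \<open>k\<close> by one cubes the power \<open>x\<close> of 2, and x^3 + 1 = (x
  + 1) * (x^2 - x + 1). The second factor supplies the extra 3, because x is -1 modulo 3. Working in
  \<open>int\<close> makes -1 and the subtraction available.\<close>

lemma three_power_dvd_two_power_plus_1:
  assumes "odd r"
  shows "(3::int) ^ Suc k dvd 2 ^ (3 ^ k * r) + 1"
proof (induction k)
  case 0
  \<comment> \<open>2 is -1 modulo 3, and the oddness of \<open>r\<close> turns (-1)^r into
    -1.\<close>
  have "(2::int) ^ r mod 3 = (- 1) ^ r mod 3"
    using power_mod[of "- 1 :: int" 3 r] by simp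
  then have "3 dvd (2::int) ^ r - (- 1) ^ r"
    by (simp only: mod_eq_dvd_iff)
  then show ?case
    using assms by simp
next
  case (Suc k)
  define x :: int where "x = 2 ^ (3 ^ k * r)"
  have dvd: "3 ^ Suc k dvd x + 1"
    using Suc by (simp add: x_def)
  then have "3 dvd x + 1"
    using dvd_mult_left[of 3 "3 ^ k"] by simp
  moreover have "x\<^sup>2 - x + 1 = (x + 1) * (x + 1) - 3 * x"
    by (simp add: algebra_simps power2_eq_square)
  ultimately have "3 dvd x\<^sup>2 - x + 1"
    by (metis dvd_diff dvd_mult2 dvd_triv_left)
  with dvd have "3 ^ Suc k * 3 dvd (x + 1) * (x\<^sup>2 - x + 1)"
    by (rule mult_dvd_mono)
  moreover have "(x + 1) * (x\<^sup>2 - x + 1) = x ^ 3 + 1"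
    by (simp add: algebra_simps power2_eq_square power3_eq_cube)
  moreover have "x ^ 3 = 2 ^ (3 ^ Suc k * r)"
    by (simp add: x_def mult_ac flip: power_mult)
  ultimately show ?case
    by (simp add: mult_ac)
qed

lemma collatz_double_minus_1: "b > 0 \<Longrightarrow> collatz (2 * b - 1) = 3 * b - 1"
  by (cases b) (simp_all add: collatz_def)

lemma collatz_seq_two_power_mult_minus_1:
  assumes "m > 0" and "j \<le> k"
  shows "collatz_seq (2 ^ k * m - 1) j = 3 ^ j * 2 ^ (k - j) * m - 1"
  using \<open>j \<le> k\<close>
proof (induction j)
  case 0
  then show ?case
    by (simp add: collatz_seq_def)
next
  case (Suc j)
  let ?b = "3 ^ j * 2 ^ (k - Suc j) * m"
  \<comment> \<open>Since j < k, a factor 2 is still left to split off, so the current term is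
    odd.\<close>
  have "k - j = Suc (k - Suc j)"
    using Suc.prems by simp
  then have "collatz_seq (2 ^ k * m - 1) j = 2 * ?b - 1"
    using Suc by simp
  then show ?case
    using collatz_double_minus_1[of ?b] \<open>m > 0\<close> by (simp add: collatz_seq_def mult.assoc)
qed

lemma collatz_seq_two_power: "i \<le> l \<Longrightarrow> collatz_seq (2 ^ l) i = 2 ^ (l - i)"
proof (induction i)
  case 0
  then show ?case
    by (simp add: collatz_seq_def)
next
  case (Suc i)
  then have "l - i = Suc (l - Suc i)"
    by simp
  with Suc show ?case
    by (simp add: collatz_seq_def collatz_def)
qed

lemma collatz_seq_add: "collatz_seq N (i + j) = collatz_seq (collatz_seq N j) i"
  by (simp add: collatz_seq_def funpow_add)

(* The pair k = r = 1 gives N = 1, whose sequence stops after 0 steps rather than l + k = 2. *)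
theorem theorem3:
  fixes k l r :: nat and N :: rat
  assumes "k > 0" and "r > 0" and "odd r"
    and "(k, r) \<noteq> (1, 1)"
    and "l = 3 ^ (k - 1) * r"
    and "N = (2 / 3) ^ k * (2 ^ l + 1) - 1"
  shows "\<exists>n::nat. n > 0 \<and> N = of_nat n \<and> terminates_at_1_after n (l + k)"
proof -
  have "(3::int) ^ k dvd 2 ^ l + 1"
    using three_power_dvd_two_power_plus_1[OF \<open>odd r\<close>, of "k - 1"] assms(1,5) by simp
  then have "int (3 ^ k) dvd int (2 ^ l + 1)"
    by (simp only: of_nat_power of_nat_numeral of_nat_add of_nat_1)
  then have "(3::nat) ^ k dvd 2 ^ l + 1"
    by (simp only: of_nat_dvd_iff)
  then obtain m :: nat where m: "2 ^ l + 1 = 3 ^ k * m"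
    by (elim dvdE)
  then have "m > 0"
    by (cases m) auto
  define n where "n = 2 ^ k * m - 1"
  \<comment> \<open>This bound ensures that the truncated subtraction in \<open>n\<close> loses
    nothing and leaves a positive number.\<close>
  have "2 ^ 1 * 1 \<le> 2 ^ k * m"
    using \<open>k > 0\<close> \<open>m > 0\<close> by (intro mult_le_mono power_increasing) auto
  then have n_Suc: "n + 1 = 2 ^ k * m" and "n > 0"
    by (simp_all add: n_def)

  have "N = of_nat n"
  proof -
    have "(2::rat) ^ l + 1 = 3 ^ k * of_nat m"
      using arg_cong[OF m, of "of_nat :: nat \<Rightarrow> rat"] by simp
    then have "N = 2 ^ k * of_nat m - 1"
      using assms(6) by (simp add: power_divide)
    also have "\<dots> = of_nat n"
      using arg_cong[OF n_Suc, of "of_nat :: nat \<Rightarrow> rat"] by simp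
    finally show ?thesis .
  qed

  have rise: "collatz_seq n j = 3 ^ j * 2 ^ (k - j) * m - 1" if "j \<le> k" for j
    unfolding n_def using \<open>m > 0\<close> that by (rule collatz_seq_two_power_mult_minus_1)
  have "collatz_seq n k = 2 ^ l"
    using rise[of k] m[symmetric] by simp
  then have fall: "collatz_seq n (i + k) = 2 ^ (l - i)" if "i \<le> l" for i
    using that by (simp add: collatz_seq_add collatz_seq_two_power)

  have "n \<noteq> 1"
  proof
    assume "n = 1"
    with n_Suc have "2 ^ k * m = 2"
      by simp
    moreover have "k = Suc (k - 1)"
      using \<open>k > 0\<close> by simp
    ultimately have "2 ^ (k - 1) * m = 1"
      by (metis mult.assoc mult_cancel1 mult_1_right power_Suc zero_neq_numeral)
    then have "k = 1" and "m = 1"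
      using \<open>k > 0\<close> by simp_all
    \<comment> \<open>The quotient equation now reads 2^l + 1 = 3. Hence l = 1, and with k = 1 also
      r = 1, the excluded pair.\<close>
    with m have "2 ^ l = (2::nat) ^ 1"
      by simp
    then have "l = 1"
      by (subst (asm) power_inject_exp) simp_all
    with assms(4,5) \<open>k = 1\<close> show False
      by simp
  qed

  have "collatz_seq n i \<noteq> 1" if "i < l + k" for i
  proof (cases "i \<le> k")
    case True
    show ?thesis
    proof (cases i)
      case 0
      with \<open>n \<noteq> 1\<close> show ?thesis
        by (simp add: collatz_seq_def)
    next
      case (Suc j)
      \<comment> \<open>After at least one step the term is one less than a multiple of 3, whereas 1
        is not.\<close>
      have "3 ^ i * 2 ^ (k - i) * m = 3 * (3 ^ j * 2 ^ (k - i) * m)"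
        using Suc by simp
      then show ?thesis
        using rise[OF True] by presburger
    qed
  next
    case False
    \<comment> \<open>Strictly between the peak and the end, the term is a power of 2 with positive
      exponent, hence even.\<close>
    then have "collatz_seq n i = 2 ^ (l - (i - k))" and "l - (i - k) > 0"
      using fall[of "i - k"] that by simp_all
    then show ?thesis
      by simp
  qed
  moreover have "collatz_seq n (l + k) = 1"
    using fall[of l] by simp
  ultimately have "terminates_at_1_after n (l + k)"
    by (simp add: terminates_at_1_after_def)
  with \<open>n > 0\<close> \<open>N = of_nat n\<close> show ?thesis
    by blast
qed

end
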